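(* Let $r,s,t$ be positive integers with $r\ge 2$ and $t \ge s \ge 2$, and let $\mathcal{L}_{r,s,t} = \{rK_2, K_{s,t}, S_{t,t}\}$. Then $\mathrm{ex}_2(K_n, \mathcal{L}_{r,s,t}) = \Theta(n)$.
   Context: A $2$-edge-coloring of $K_n$ is a partition $E(K_n)=E(R)\cup E(B)$ into red and blue edges. The coloring contains an induced monochromatic copy of a graph $H$ if there is $U\subseteq V(K_n)$ with $|U|=|V(H)|$ such that the red edges inside $U$, or the blue edges inside $U$, form a graph isomorphic to $H$. For a family $\mathcal{F}$ of graphs containing no complete or empty graphs, $\mathrm{ex}_2(K_n,\mathcal{F})$ is the least integer $m$ such that, for large $n$, every $2$-edge-coloring of $K_n$ with more than $m$ edges in each color contains an induced monochromatic member of $\mathcal{F}$ (equivalently the largest $m\le\frac12\binom n2$ for which some coloring with exactly $m$ edges in the smaller color class avoids all induced monochromatic members of $\mathcal{F}$); it is $\infty$ if no such bound exists. $rK_2$ is a matching with $r$ edges; $K_{s,t}$ is the complete bipartite graph with parts of sizes $s,t$; $S_{t,t}$ is the complete split graph consisting of a clique on $t$ vertices, an independent set on $t$ vertices, and all edges between them. Asymptotics are as $n\to\infty$ with constants depending on $r,s,t$. *)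

theory Defs
  imports Complex_Main "HOL-Library.Ramsey" "HOL-Library.Extended_Nat" "HOL-Library.Landau_Symbols"
begin

text \<open>A graph is a pair of a vertex set and a set of two-element subsets of it.
  In all graphs below the vertices are natural numbers; graphs matter only up to isomorphism.\<close>

type_synonym 'a graph = "'a set \<times> 'a set set"

definition graph :: "'a graph \<Rightarrow> bool" where
  "graph G \<longleftrightarrow> finite (fst G) \<and> snd G \<subseteq> [fst G]\<^bsup>2\<^esup>"

definition graph_isomorphic :: "'a graph \<Rightarrow> 'b graph \<Rightarrow> bool" where
  "graph_isomorphic G H \<longleftrightarrow>
     (\<exists>f. bij_betw f (fst G) (fst H) \<and> snd H = (\<lambda>e. f ` e) ` snd G)"

definition two_edge_coloring :: "nat \<Rightarrow> nat set set \<Rightarrow> nat set set \<Rightarrow> bool" where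
  "two_edge_coloring n R B \<longleftrightarrow> R \<union> B = [{..<n}]\<^bsup>2\<^esup> \<and> R \<inter> B = {}"

definition induced_mono_copy ::
    "nat \<Rightarrow> nat set set \<Rightarrow> nat set set \<Rightarrow> 'a graph \<Rightarrow> bool" where
  "induced_mono_copy n R B H \<longleftrightarrow>
     (\<exists>U \<subseteq> {..<n}. card U = card (fst H) \<and>
        (graph_isomorphic (U, R \<inter> [U]\<^bsup>2\<^esup>) H \<or> graph_isomorphic (U, B \<inter> [U]\<^bsup>2\<^esup>) H))"

text \<open>More than \<open>m\<close> edges in each color force an induced monochromatic member of the family.\<close>

definition forces_mono :: "nat \<Rightarrow> nat \<Rightarrow> 'a graph set \<Rightarrow> bool" where
  "forces_mono n m F \<longleftrightarrow>
     (\<forall>R B. two_edge_coloring n R B \<and> card R > m \<and> card B > m \<longrightarrow>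
        (\<exists>H\<in>F. induced_mono_copy n R B H))"

text \<open>A coloring of \<open>K\<^sub>n\<close> with more than \<open>m\<close> edges in each color exists iff
  \<open>m < (n choose 2) div 2\<close>. For larger \<open>m\<close> the forcing condition is vacuous, so such \<open>m\<close> are
  not admitted as bounds; if no admissible bound exists, the infimum of the empty set of extended
  naturals is \<open>\<infinity>\<close>. Otherwise the infimum is the least admissible bound.\<close>

definition ex2 :: "nat \<Rightarrow> 'a graph set \<Rightarrow> enat" where
  "ex2 n F = Inf {enat m | m. m < (n choose 2) div 2 \<and> forces_mono n m F}"

definition matching_graph :: "nat \<Rightarrow> nat graph" where
  "matching_graph r = ({..<2 * r}, {{2 * i, 2 * i + 1} | i. i < r})"

definition complete_bipartite_graph :: "nat \<Rightarrow> nat \<Rightarrow> nat graph" where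
  "complete_bipartite_graph s t =
     ({..<s + t}, {{i, j} | i j. i \<in> {..<s} \<and> j \<in> {s..<s + t}})"

text \<open>The clique is on \<open>{..<s}\<close>, the independent set is \<open>{s..<s + t}\<close>.\<close>

definition complete_split_graph :: "nat \<Rightarrow> nat \<Rightarrow> nat graph" where
  "complete_split_graph s t =
     ({..<s + t}, [{..<s}]\<^bsup>2\<^esup> \<union> {{i, j} | i j. i \<in> {..<s} \<and> j \<in> {s..<s + t}})"

definition L_family :: "nat \<Rightarrow> nat \<Rightarrow> nat \<Rightarrow> nat graph set" where
  "L_family r s t =
     {matching_graph r, complete_bipartite_graph s t, complete_split_graph t t}"


text \<open>Sanity checks: the family consists of graphs that are neither complete nor empty, and for such
  families \<^const>\<open>ex2\<close> is the largest size of the smaller color class in a coloring avoiding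
  the family, unless that size is the trivial maximum \<open>(n choose 2) div 2\<close>.\<close>

lemma L_family_graph: "H \<in> L_family r s t \<Longrightarrow> graph H"
  using nsets_mono[of "{..<t}" "{..<t + t}" 2]
  by (auto simp: L_family_def graph_def matching_graph_def complete_bipartite_graph_def
      complete_split_graph_def)

lemma L_family_not_empty_complete:
  assumes "r \<ge> 2" "s \<ge> 2" "t \<ge> s" "H \<in> L_family r s t"
  shows "snd H \<noteq> {}" "snd H \<noteq> [fst H]\<^bsup>2\<^esup>"
proof -
  have "\<exists>i. {0,1} = {2 * i, 2 * i + 1} \<and> i < r"
    using assms by (intro exI[of _ 0]) auto
  then have M0: "{0,1} \<in> snd (matching_graph r)"
    by (simp add: matching_graph_def)
  have "{0,2} \<noteq> {2 * i, 2 * i + 1}" for i :: nat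
    unfolding doubleton_eq_iff by presburger
  then have M: "{0,2} \<notin> snd (matching_graph r)" "{0,2} \<in> [fst (matching_graph r)]\<^bsup>2\<^esup>"
    using assms by (auto simp: matching_graph_def)
  have "\<exists>i j. {0,s} = {i,j} \<and> i \<in> {..<s} \<and> j \<in> {s..<s + t}"
    using assms by (intro exI[of _ 0] exI[of _ s]) auto
  then have K0: "{0,s} \<in> snd (complete_bipartite_graph s t)"
    by (simp add: complete_bipartite_graph_def)
  have K: "{0,1} \<notin> snd (complete_bipartite_graph s t)"
    "{0,1} \<in> [fst (complete_bipartite_graph s t)]\<^bsup>2\<^esup>"
    using assms by (auto simp: complete_bipartite_graph_def doubleton_eq_iff)
  have S0: "{0,1} \<in> snd (complete_split_graph t t)"
    using assms by (simp add: complete_split_graph_def)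
  have "{t,t+1} \<noteq> {i,j}" if "i < t" for i j
    using that by (auto simp: doubleton_eq_iff)
  then have S: "{t,t+1} \<notin> snd (complete_split_graph t t)"
    "{t,t+1} \<in> [fst (complete_split_graph t t)]\<^bsup>2\<^esup>"
    using assms by (auto simp: complete_split_graph_def)
  show "snd H \<noteq> {}" "snd H \<noteq> [fst H]\<^bsup>2\<^esup>"
    using M0 M K0 K S0 S assms(4) unfolding L_family_def by blast+
qed

lemma ex2_eq_Max:
  fixes F :: "'a graph set"
  assumes "\<And>H. H \<in> F \<Longrightarrow> snd H \<noteq> {} \<and> snd H \<noteq> [fst H]\<^bsup>2\<^esup>"
  defines "A \<equiv> \<lambda>n. {min (card R) (card B) | R B.
             two_edge_coloring n R B \<and> \<not> (\<exists>H\<in>F. induced_mono_copy n R B H)}"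
  shows "finite (A n)" "A n \<noteq> {}"
    "ex2 n F = (if Max (A n) = (n choose 2) div 2 then \<infinity> else enat (Max (A n)))"
proof -
  define N where "N = (n choose 2) div 2"
  have col: "min (card R) (card B) \<le> N" if "two_edge_coloring n R B" for R B
  proof -
    have "finite (R \<union> B)"
      using that by (simp add: two_edge_coloring_def finite_imp_finite_nsets)
    then have "card R + card B = n choose 2"
      using that card_Un_disjoint[of R B] by (simp add: two_edge_coloring_def)
    then show ?thesis unfolding N_def by linarith
  qed
  then have sub: "A n \<subseteq> {..N}" unfolding A_def by auto
  then show fin: "finite (A n)" using finite_subset by blast
  have "\<not> induced_mono_copy n {} ([{..<n}]\<^bsup>2\<^esup>) H" if "H \<in> F" for H
  proof
    assume "induced_mono_copy n {} ([{..<n}]\<^bsup>2\<^esup>) H"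
    then obtain U where U: "U \<subseteq> {..<n}" "graph_isomorphic (U, {}) H \<or>
        graph_isomorphic (U, [{..<n}]\<^bsup>2\<^esup> \<inter> [U]\<^bsup>2\<^esup>) H"
      by (auto simp: induced_mono_copy_def)
    have "[{..<n}]\<^bsup>2\<^esup> \<inter> [U]\<^bsup>2\<^esup> = [U]\<^bsup>2\<^esup>" using nsets_mono[OF U(1)] by blast
    with U assms(1)[OF that] obtain f where f: "bij_betw f U (fst H)"
      "snd H = (\<lambda>e. f ` e) ` [U]\<^bsup>2\<^esup>"
      by (auto simp: graph_isomorphic_def)
    then show False
      using bij_betw_nsets[OF f(1), of 2] assms(1)[OF that] by (simp add: bij_betw_def)
  qed
  then have "0 \<in> A n"
    unfolding A_def two_edge_coloring_def mem_Collect_eq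
    by (intro exI[of _ "{}"] exI[of _ "[{..<n}]\<^bsup>2\<^esup>"]) auto
  then show ne: "A n \<noteq> {}" by blast
  have forces: "forces_mono n m F \<longleftrightarrow> Max (A n) \<le> m" for m
  proof -
    have "Max (A n) \<le> m \<longleftrightarrow> (\<forall>k\<in>A n. k \<le> m)" using fin ne by simp
    also have "\<dots> \<longleftrightarrow> (\<forall>R B. two_edge_coloring n R B \<and> \<not> (\<exists>H\<in>F. induced_mono_copy n R B H)
        \<longrightarrow> min (card R) (card B) \<le> m)"
      unfolding A_def by blast
    also have "\<dots> \<longleftrightarrow> forces_mono n m F"
      unfolding forces_mono_def min_le_iff_disj not_le[symmetric] by blast
    finally show ?thesis by simp
  qed
  have le: "Max (A n) \<le> N" using sub fin ne by (auto simp: Max_le_iff)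
  show "ex2 n F = (if Max (A n) = (n choose 2) div 2 then \<infinity> else enat (Max (A n)))"
  proof (cases "Max (A n) = N")
    case True
    then have "{enat m | m. m < (n choose 2) div 2 \<and> forces_mono n m F} = {}"
      by (auto simp: forces N_def)
    then show ?thesis using True unfolding ex2_def N_def by (simp add: Inf_enat_def)
  next
    case False
    then have "Inf {enat m | m. m < (n choose 2) div 2 \<and> forces_mono n m F} = enat (Max (A n))"
      using le by (intro cInf_eq_minimum) (auto simp: forces N_def)
    then show ?thesis using False unfolding ex2_def N_def by simp
  qed
qed

end

theory Submission
  imports Defs
begin

text \<open>For the lower bound colour a spanning star red: any two vertices other than the centre, and
  likewise any two edges at the centre, look alike, which no member of the family tolerates.

  For the upper bound, linearly many red edges contain a large red matching. By Ramsey's theorem we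
  may assume that the colours within and between its two sides depend only on the order of the
  indices. Comparing the first half of one side with the last half of the other side, every pattern
  other than a constant one yields a monochromatic \<open>K\<^sub>s\<^sub>,\<^sub>t\<close> or \<open>S\<^sub>t\<^sub>,\<^sub>t\<close>, and the constant blue pattern
  is an induced red matching. So there is a large red clique, and by symmetry a large blue clique.
  Making the colours between these two cliques homogeneous gives a monochromatic \<open>S\<^sub>t\<^sub>,\<^sub>t\<close>.\<close>

section \<open>Ramsey's theorem for several relations on indices\<close>

text \<open>Ramsey's theorem for the graph whose edges are the pairs \<open>i < j\<close> with
  \<open>P i j\<close>. The relation \<open>P\<close> may be asymmetric, so the homogeneous set is
  enumerated increasingly: then \<open>P\<close> is evaluated only on pairs in their natural
  order.\<close>

lemma ramsey_increasing:
  fixes k :: nat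
  shows "\<exists>N. \<forall>P :: nat \<Rightarrow> nat \<Rightarrow> bool. \<exists>h. strict_mono_on {..<k} h \<and> h ` {..<k} \<subseteq> {..<N} \<and>
     (\<exists>c. \<forall>i j. i < j \<and> j < k \<longrightarrow> P (h i) (h j) = c)"
proof -
  obtain N where N: "\<And>(V :: nat set) E. finite V \<Longrightarrow> card V \<ge> N \<Longrightarrow>
      \<exists>W \<subseteq> V. card W = k \<and> clique W E \<or> card W = k \<and> indep W E"
    using ramsey2[of k k, where ?'a = nat] by blast
  show ?thesis
  proof (intro exI[of _ N] allI)
    fix P :: "nat \<Rightarrow> nat \<Rightarrow> bool"
    define E where "E = {{i, j} | i j. i < j \<and> P i j}"
    have E: "{i, j} \<in> E \<longleftrightarrow> P i j" if "i < j" for i j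
      using that unfolding E_def by (auto simp: doubleton_eq_iff)
    obtain W where W: "W \<subseteq> {..<N}" "card W = k" "clique W E \<or> indep W E"
      using N[of "{..<N}" E] by auto
    then have "finite W"
      using finite_subset by blast
    then obtain h :: "nat \<Rightarrow> nat" where h: "strict_mono_on {..<k} h" "\<And>i. i < k \<Longrightarrow> h i \<in> W"
      using finite_enumerate W(2) by metis
    \<comment> \<open>The truth value of \<open>clique W E\<close> is the constant: where it is
      False, \<open>W\<close> is independent.\<close>
    have "P (h i) (h j) = clique W E" if "i < j" "j < k" for i j
    proof -
      have "h i < h j"
        using h(1) that by (auto simp: strict_mono_on_def)
      moreover have "h i \<in> W" "h j \<in> W"
        using h(2) that by auto
      ultimately show ?thesis
        using W(3) E[of "h i" "h j"] unfolding clique_def indep_def by (metis nat_neq_iff)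
    qed
    then show "\<exists>h. strict_mono_on {..<k} h \<and> h ` {..<k} \<subseteq> {..<N} \<and>
        (\<exists>c. \<forall>i j. i < j \<and> j < k \<longrightarrow> P (h i) (h j) = c)"
      using h W(1) by (intro exI[of _ h]) auto
  qed
qed

text \<open>Induction on the number of relations: the first is made homogeneous on as many indices
  as the remaining ones require. Passing to a subsequence with an increasing \<open>h\<close>
  preserves what was already achieved.\<close>

lemma ramsey_increasing_list:
  fixes k :: nat
  shows "\<exists>N. \<forall>Ps :: (nat \<Rightarrow> nat \<Rightarrow> bool) list. length Ps = m \<longrightarrow>
     (\<exists>h. strict_mono_on {..<k} h \<and> h ` {..<k} \<subseteq> {..<N} \<and>
       (\<forall>P \<in> set Ps. \<exists>c. \<forall>i j. i < j \<and> j < k \<longrightarrow> P (h i) (h j) = c))"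
proof (induction m)
  case 0
  show ?case
    by (intro exI[of _ k] allI impI exI[of _ id]) (auto simp: strict_mono_on_def)
next
  case (Suc m)
  then obtain N where N: "\<And>Ps :: (nat \<Rightarrow> nat \<Rightarrow> bool) list. length Ps = m \<Longrightarrow>
     \<exists>h. strict_mono_on {..<k} h \<and> h ` {..<k} \<subseteq> {..<N} \<and>
       (\<forall>P \<in> set Ps. \<exists>c. \<forall>i j. i < j \<and> j < k \<longrightarrow> P (h i) (h j) = c)"
    by blast
  obtain M where M: "\<And>P :: nat \<Rightarrow> nat \<Rightarrow> bool. \<exists>h. strict_mono_on {..<N} h \<and>
     h ` {..<N} \<subseteq> {..<M} \<and> (\<exists>c. \<forall>i j. i < j \<and> j < N \<longrightarrow> P (h i) (h j) = c)"
    using ramsey_increasing[of N] by blast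
  show ?case
  proof (intro exI[of _ M] allI impI)
    fix Ps :: "(nat \<Rightarrow> nat \<Rightarrow> bool) list"
    assume "length Ps = Suc m"
    then obtain P Qs where Ps: "Ps = P # Qs" "length Qs = m"
      by (cases Ps) auto
    obtain g where "strict_mono_on {..<N} g \<and> g ` {..<N} \<subseteq> {..<M} \<and>
        (\<exists>c. \<forall>i j. i < j \<and> j < N \<longrightarrow> P (g i) (g j) = c)"
      using M[of P] ..
    then have g: "strict_mono_on {..<N} g" "g ` {..<N} \<subseteq> {..<M}"
        "\<exists>c. \<forall>i j. i < j \<and> j < N \<longrightarrow> P (g i) (g j) = c"
      by auto
    from g(3) obtain c where c: "\<forall>i j. i < j \<and> j < N \<longrightarrow> P (g i) (g j) = c" ..
    \<comment> \<open>The remaining relations are pulled back along \<open>g\<close> before the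
      induction hypothesis is applied.\<close>
    obtain h where h: "strict_mono_on {..<k} h" "h ` {..<k} \<subseteq> {..<N}"
        "\<forall>Q \<in> set Qs. \<exists>c. \<forall>i j. i < j \<and> j < k \<longrightarrow> Q (g (h i)) (g (h j)) = c"
      using N[of "map (\<lambda>Q i j. Q (g i) (g j)) Qs"] Ps(2) by auto
    have hN: "h i < N" if "i < k" for i
      using h(2) that by auto
    have hm: "h i < h j" if "i < j" "j < k" for i j
      using h(1) that by (auto simp: strict_mono_on_def)
    show "\<exists>h. strict_mono_on {..<k} h \<and> h ` {..<k} \<subseteq> {..<M} \<and>
       (\<forall>P \<in> set Ps. \<exists>c. \<forall>i j. i < j \<and> j < k \<longrightarrow> P (h i) (h j) = c)"
    proof (intro exI[of _ "g \<circ> h"] conjI)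
      show "strict_mono_on {..<k} (g \<circ> h)"
        using g(1) hN hm by (auto simp: strict_mono_on_def)
      show "(g \<circ> h) ` {..<k} \<subseteq> {..<M}"
        using g(2) hN by auto
      show "\<forall>P \<in> set Ps. \<exists>c. \<forall>i j. i < j \<and> j < k \<longrightarrow> P ((g \<circ> h) i) ((g \<circ> h) j) = c"
        using h(3) c hN hm unfolding Ps(1) by auto
    qed
  qed
qed

section \<open>Induced monochromatic copies\<close>

lemma two_edge_coloring_sym: "two_edge_coloring n R B \<longleftrightarrow> two_edge_coloring n B R"
  by (auto simp: two_edge_coloring_def)

lemma induced_mono_copy_sym: "induced_mono_copy n R B H \<longleftrightarrow> induced_mono_copy n B R H"
  by (auto simp: induced_mono_copy_def)

lemma induced_mono_copyI:
  assumes H: "graph H" and inj: "inj_on f (fst H)" and sub: "f ` fst H \<subseteq> {..<n}"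
    and edge: "\<And>i j. i \<in> fst H \<Longrightarrow> j \<in> fst H \<Longrightarrow> i \<noteq> j \<Longrightarrow> {f i, f j} \<in> R \<longleftrightarrow> {i, j} \<in> snd H"
  shows "induced_mono_copy n R B H"
proof -
  define U where "U = f ` fst H"
  \<comment> \<open>The definition of a copy asks for a map from the colored set to
    \<open>H\<close>, hence the inverse of the embedding.\<close>
  define g where "g = inv_into (fst H) f"
  have g: "bij_betw g U (fst H)"
    unfolding g_def U_def using inj by (intro bij_betw_inv_into inj_on_imp_bij_betw)
  have gf: "g (f i) = i" if "i \<in> fst H" for i
    unfolding g_def using inj that by simp
  have "snd H = (\<lambda>e. g ` e) ` (R \<inter> [U]\<^bsup>2\<^esup>)"
  proof (intro equalityI subsetI)
    fix e assume e: "e \<in> snd H"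
    with H obtain i j where ij: "e = {i, j}" "i \<in> fst H" "j \<in> fst H" "i \<noteq> j"
      unfolding graph_def by (meson nsets2_E subsetD)
    have "{f i, f j} \<in> R \<inter> [U]\<^bsup>2\<^esup>"
      using edge ij e inj by (auto simp: U_def inj_on_def)
    moreover have "e = g ` {f i, f j}"
      using ij gf by simp
    ultimately show "e \<in> (\<lambda>e. g ` e) ` (R \<inter> [U]\<^bsup>2\<^esup>)"
      by blast
  next
    fix e assume "e \<in> (\<lambda>e. g ` e) ` (R \<inter> [U]\<^bsup>2\<^esup>)"
    then obtain d where d: "d \<in> R" "d \<in> [U]\<^bsup>2\<^esup>" "e = g ` d"
      by blast
    from d(2) obtain u v where "d = {u, v}" "u \<in> U" "v \<in> U" "u \<noteq> v"
      by (rule nsets2_E)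
    then obtain i j where ij: "d = {f i, f j}" "i \<in> fst H" "j \<in> fst H" "i \<noteq> j"
      unfolding U_def by auto
    then show "e \<in> snd H"
      using edge d gf by simp
  qed
  then have "graph_isomorphic (U, R \<inter> [U]\<^bsup>2\<^esup>) H"
    unfolding graph_isomorphic_def using g by auto
  moreover have "card U = card (fst H)"
    unfolding U_def using inj by (rule card_image)
  moreover have "U \<subseteq> {..<n}"
    unfolding U_def by (rule sub)
  ultimately show ?thesis
    unfolding induced_mono_copy_def by blast
qed

text \<open>The common shape of \<open>K_{s,t}\<close> and \<open>S_{t,t}\<close>: two blocks
  completely joined to each other, with \<open>\<alpha>\<close> and \<open>\<beta>\<close> telling
  whether each block is a clique or independent. The embedding uses \<open>p\<close> on the first
  block and \<open>q\<close>, shifted by \<open>m\<close>, on the second.\<close>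

lemma induced_mono_copy_blocksI:
  fixes m k :: nat
  assumes H: "graph H" "fst H = {..<m + k}"
    and p: "inj_on p {..<m}" "p ` {..<m} \<subseteq> {..<n}"
    and q: "inj_on q {..<k}" "q ` {..<k} \<subseteq> {..<n}"
    and disj: "p ` {..<m} \<inter> q ` {..<k} = {}"
    and cross: "\<And>i j. i < m \<Longrightarrow> j < k \<Longrightarrow> {p i, q j} \<in> R"
    and pp: "\<And>i j. i < m \<Longrightarrow> j < m \<Longrightarrow> i \<noteq> j \<Longrightarrow> {p i, p j} \<in> R \<longleftrightarrow> \<alpha>"
    and qq: "\<And>i j. i < k \<Longrightarrow> j < k \<Longrightarrow> i \<noteq> j \<Longrightarrow> {q i, q j} \<in> R \<longleftrightarrow> \<beta>"
    and edge: "\<And>i j. i < m + k \<Longrightarrow> j < m + k \<Longrightarrow> i \<noteq> j \<Longrightarrow> {i, j} \<in> snd H \<longleftrightarrow>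
      (if i < m \<and> j < m then \<alpha> else if m \<le> i \<and> m \<le> j then \<beta> else True)"
  shows "induced_mono_copy n R B H"
proof (rule induced_mono_copyI[OF H(1)])
  let ?f = "\<lambda>i. if i < m then p i else q (i - m)"
  have pq: "p i \<noteq> q j" if "i < m" "j < k" for i j
    using disj that by blast
  show "inj_on ?f (fst H)"
  proof (rule inj_onI)
    fix i j assume ij: "i \<in> fst H" "j \<in> fst H" "?f i = ?f j"
    consider "i < m" "j < m" | "i < m" "\<not> j < m" | "\<not> i < m" "j < m" | "\<not> i < m" "\<not> j < m"
      by blast
    then show "i = j"
    proof cases
      case 1
      then show ?thesis
        using ij(3) inj_onD[OF p(1), of i j] by simp
    next
      case 2
      then show ?thesis
        using ij pq[of i "j - m"] H(2) by simp
    next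
      case 3
      then show ?thesis
        using ij pq[of j "i - m"] H(2) by fastforce
    next
      case 4
      then have "i - m = j - m"
        using ij inj_onD[OF q(1), of "i - m" "j - m"] H(2) by fastforce
      with 4 show ?thesis
        by linarith
    qed
  qed
  show "?f ` fst H \<subseteq> {..<n}"
    using p(2) q(2) H(2) by (auto simp: image_subset_iff)
  fix i j assume ij: "i \<in> fst H" "j \<in> fst H" "i \<noteq> j"
  consider "i < m" "j < m" | "i < m" "\<not> j < m" | "\<not> i < m" "j < m" | "\<not> i < m" "\<not> j < m"
    by blast
  then show "{?f i, ?f j} \<in> R \<longleftrightarrow> {i, j} \<in> snd H"
  proof cases
    case 1
    then show ?thesis
      using ij pp[of i j] edge[of i j] H(2) by simp
  next
    case 2
    then show ?thesis
      using ij cross[of i "j - m"] edge[of i j] H(2) by simp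
  next
    case 3
    then show ?thesis
      using ij cross[of j "i - m"] edge[of i j] H(2) by (simp add: insert_commute)
  next
    case 4
    then show ?thesis
      using ij qq[of "i - m" "j - m"] edge[of i j] H(2) by simp
  qed
qed

text \<open>Turns the isomorphism around, so that edges of \<open>H\<close> can be tested by the
  color of their images. This serves to refute copies.\<close>

lemma graph_isomorphic_edgesE:
  assumes "graph_isomorphic (U, E \<inter> [U]\<^bsup>2\<^esup>) H"
  obtains g where "inj_on g (fst H)" "g ` fst H \<subseteq> U"
    "\<And>i j. i \<in> fst H \<Longrightarrow> j \<in> fst H \<Longrightarrow> i \<noteq> j \<Longrightarrow> {i, j} \<in> snd H \<longleftrightarrow> {g i, g j} \<in> E"
proof -
  obtain f where f: "bij_betw f U (fst H)" "snd H = (\<lambda>e. f ` e) ` (E \<inter> [U]\<^bsup>2\<^esup>)"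
    using assms by (auto simp: graph_isomorphic_def)
  define g where "g = inv_into U f"
  have g: "bij_betw g (fst H) U"
    unfolding g_def using f(1) by (rule bij_betw_inv_into)
  have fg: "f (g i) = i" if "i \<in> fst H" for i
    unfolding g_def using f(1) that by (metis bij_betw_inv_into_right)
  have gf: "g (f x) = x" if "x \<in> U" for x
    unfolding g_def using f(1) that by (metis bij_betw_inv_into_left)
  have gU: "g i \<in> U" if "i \<in> fst H" for i
    using g that by (auto simp: bij_betw_def)
  show thesis
  proof (rule that)
    show "inj_on g (fst H)" "g ` fst H \<subseteq> U"
      using g by (auto simp: bij_betw_def)
    fix i j assume ij: "i \<in> fst H" "j \<in> fst H" "i \<noteq> j"
    show "{i, j} \<in> snd H \<longleftrightarrow> {g i, g j} \<in> E"
    proof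
      assume "{i, j} \<in> snd H"
      then obtain d where d: "d \<in> E" "d \<in> [U]\<^bsup>2\<^esup>" "{i, j} = f ` d"
        using f(2) by auto
      have "g ` f ` d = d"
        using d(2) gf by (force simp: nsets_def image_image)
      then have "d = {g i, g j}"
        using d(3) by (metis image_empty image_insert)
      then show "{g i, g j} \<in> E"
        using d(1) by simp
    next
      assume "{g i, g j} \<in> E"
      moreover have "g i \<noteq> g j"
        using fg ij by metis
      ultimately have "{g i, g j} \<in> E \<inter> [U]\<^bsup>2\<^esup>"
        using gU ij by simp
      then have "f ` {g i, g j} \<in> snd H"
        unfolding f(2) by blast
      then show "{i, j} \<in> snd H"
        using fg ij by simp
    qed
  qed
qed

section \<open>Adjacency in the three forbidden graphs\<close>

lemma matching_graph_edge_iff: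
  "{i, j} \<in> snd (matching_graph r) \<longleftrightarrow>
     i \<noteq> j \<and> i div 2 = j div 2 \<and> i < 2 * r \<and> j < 2 * r"
proof
  assume "i \<noteq> j \<and> i div 2 = j div 2 \<and> i < 2 * r \<and> j < 2 * r"
  then have "{i, j} = {2 * (i div 2), 2 * (i div 2) + 1} \<and> i div 2 < r"
    unfolding doubleton_eq_iff by presburger
  then show "{i, j} \<in> snd (matching_graph r)"
    unfolding matching_graph_def by auto
qed (auto simp: matching_graph_def doubleton_eq_iff)

lemma doubleton_in_cross_iff:
  "{x, y} \<in> {{i, j} | i j. i \<in> A \<and> j \<in> C} \<longleftrightarrow> x \<in> A \<and> y \<in> C \<or> y \<in> A \<and> x \<in> C"
  unfolding mem_Collect_eq doubleton_eq_iff by blast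

lemma complete_bipartite_graph_edge_iff:
  "{i, j} \<in> snd (complete_bipartite_graph s t) \<longleftrightarrow>
     (i < s \<longleftrightarrow> s \<le> j) \<and> i < s + t \<and> j < s + t"
  unfolding complete_bipartite_graph_def snd_conv doubleton_in_cross_iff by auto

lemma complete_split_graph_edge_iff:
  "{i, j} \<in> snd (complete_split_graph s t) \<longleftrightarrow>
     i \<noteq> j \<and> (i < s \<or> j < s) \<and> i < s + t \<and> j < s + t"
  unfolding complete_split_graph_def snd_conv Un_iff doubleton_in_nsets_2 doubleton_in_cross_iff
  by auto

section \<open>Matchings in graphs with many edges\<close>

text \<open>Greedy choice: take an edge \<open>{x, y}\<close> and discard all edges meeting it. Each
  endpoint lies on at most \<open>n\<close> edges, so a step costs at most \<open>2 * n\<close>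
  edges, and what remains avoids \<open>x\<close> and \<open>y\<close>.\<close>

lemma matching_if_many_edges:
  assumes "E \<subseteq> [{..<n}]\<^bsup>2\<^esup>" "card E > 2 * M * n"
  shows "\<exists>a b. inj_on a {..<M} \<and> inj_on b {..<M} \<and> a ` {..<M} \<inter> b ` {..<M} = {} \<and>
    (\<forall>i<M. {a i, b i} \<in> E)"
  using assms
proof (induction M arbitrary: E)
  case 0
  show ?case by simp
next
  case (Suc M)
  have "finite E"
    using Suc.prems(1) finite_imp_finite_nsets finite_subset finite_lessThan by metis
  have "E \<noteq> {}"
    using Suc.prems(2) by auto
  then obtain x y where xy: "{x, y} \<in> E" "x \<noteq> y" "x < n" "y < n"
    using Suc.prems(1) by (metis ex_in_conv lessThan_iff nsets2_E subsetD)
  define F where "F = {e \<in> E. x \<notin> e \<and> y \<notin> e}"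
  have star: "card {e \<in> E. z \<in> e} \<le> n" for z
  proof -
    have "{e \<in> E. z \<in> e} \<subseteq> (\<lambda>w. {z, w}) ` {..<n}"
    proof
      fix e assume "e \<in> {e \<in> E. z \<in> e}"
      then obtain u v where "e = {u, v}" "u < n" "v < n" "z \<in> e"
        using Suc.prems(1) by (metis (no_types, lifting) lessThan_iff mem_Collect_eq nsets2_E subsetD)
      then show "e \<in> (\<lambda>w. {z, w}) ` {..<n}"
        by auto
    qed
    then show ?thesis
      by (metis card_lessThan finite_lessThan surj_card_le)
  qed
  have "E = F \<union> ({e \<in> E. x \<in> e} \<union> {e \<in> E. y \<in> e})"
    unfolding F_def by auto
  then have "card E \<le> card F + (card {e \<in> E. x \<in> e} + card {e \<in> E. y \<in> e})"
    by (metis (no_types, lifting) add_left_mono card_Un_le order_trans)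
  then have "card F > 2 * M * n"
    using star[of x] star[of y] Suc.prems(2) by (simp add: algebra_simps)
  moreover have "F \<subseteq> [{..<n}]\<^bsup>2\<^esup>"
    using Suc.prems(1) unfolding F_def by auto
  ultimately obtain a b where ab: "inj_on a {..<M}" "inj_on b {..<M}"
    "a ` {..<M} \<inter> b ` {..<M} = {}" "\<And>i. i < M \<Longrightarrow> {a i, b i} \<in> F"
    using Suc.IH[of F] by metis
  have new: "a i \<noteq> x" "a i \<noteq> y" "b i \<noteq> x" "b i \<noteq> y" "{a i, b i} \<in> E" if "i < M" for i
    using ab(4)[OF that] unfolding F_def by auto
  have "inj_on (a(M := x)) {..<Suc M}" "inj_on (b(M := y)) {..<Suc M}"
    using ab(1,2) new by (auto simp: lessThan_Suc fun_upd_image intro!: inj_on_fun_updI)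
  moreover have "(a(M := x)) ` {..<Suc M} \<inter> (b(M := y)) ` {..<Suc M} = {}"
  proof -
    have "(a(M := x)) i \<noteq> (b(M := y)) j" if "i < Suc M" "j < Suc M" for i j
    proof -
      have "a i \<noteq> b j" if "i < M" "j < M"
        using ab(3) that by blast
      then show ?thesis
        using new(2)[of i] new(3)[of j] xy(2) that by (auto simp: less_Suc_eq)
    qed
    then show ?thesis
      by blast
  qed
  moreover have "\<forall>i<Suc M. {(a(M := x)) i, (b(M := y)) i} \<in> E"
    using new(5) xy(1) by (auto simp: less_Suc_eq)
  ultimately show ?case
    by blast
qed

section \<open>The upper bound\<close>

text \<open>The situation to be refuted when both color classes are large.\<close>

locale avoiding_coloring =
  fixes n r s t :: nat and R B :: "nat set set"
  assumes coloring: "two_edge_coloring n R B"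
    and s_le_t: "s \<le> t" and s_ge_2: "2 \<le> s"
    and avoid: "H \<in> L_family r s t \<Longrightarrow> \<not> induced_mono_copy n R B H"
begin

text \<open>Lets every fact about red in this setting be reused for blue.\<close>

lemma swap: "avoiding_coloring n r s t B R"
  using coloring s_le_t s_ge_2 avoid
  by unfold_locales (auto simp: two_edge_coloring_sym induced_mono_copy_sym)

lemma blue_iff: "{x, y} \<in> B \<longleftrightarrow> {x, y} \<notin> R" if "x < n" "y < n" "x \<noteq> y"
proof -
  have "{x, y} \<in> R \<union> B"
    using coloring that by (simp add: two_edge_coloring_def)
  then show ?thesis
    using coloring by (auto simp: two_edge_coloring_def)
qed

text \<open>Of two homogeneous \<open>t\<close>-sets joined entirely in red, two blue ones give a
  red \<open>K_{s,t}\<close>, and one red with one blue gives a red \<open>S_{t,t}\<close>. Only two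
  red ones survive.\<close>

lemma red_blocks:
  assumes p: "inj_on p {..<t}" "p ` {..<t} \<subseteq> {..<n}"
    and q: "inj_on q {..<t}" "q ` {..<t} \<subseteq> {..<n}"
    and disj: "p ` {..<t} \<inter> q ` {..<t} = {}"
    and cross: "\<And>i j. i < t \<Longrightarrow> j < t \<Longrightarrow> {p i, q j} \<in> R"
    and pp: "\<And>i j. i < j \<Longrightarrow> j < t \<Longrightarrow> {p i, p j} \<in> R \<longleftrightarrow> \<alpha>"
    and qq: "\<And>i j. i < j \<Longrightarrow> j < t \<Longrightarrow> {q i, q j} \<in> R \<longleftrightarrow> \<beta>"
  shows "\<alpha> \<and> \<beta>"
proof -
  have pp': "{p i, p j} \<in> R \<longleftrightarrow> \<alpha>" if "i < t" "j < t" "i \<noteq> j" for i j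
    using pp[of i j] pp[of j i] that by (metis insert_commute linorder_neqE_nat)
  have qq': "{q i, q j} \<in> R \<longleftrightarrow> \<beta>" if "i < t" "j < t" "i \<noteq> j" for i j
    using qq[of i j] qq[of j i] that by (metis insert_commute linorder_neqE_nat)
  have cross': "{q i, p j} \<in> R" if "i < t" "j < t" for i j
    using cross[OF that(2,1)] by (simp add: insert_commute)
  have G: "graph H" if "H \<in> L_family r s t" for H
    using that by (rule L_family_graph)
  have False if "\<not> \<alpha>" "\<not> \<beta>"
  proof -
    let ?H = "complete_bipartite_graph s t"
    have H: "?H \<in> L_family r s t" and V: "fst ?H = {..<s + t}"
      by (auto simp: L_family_def complete_bipartite_graph_def)
    \<comment> \<open>Only the first \<open>s\<close> vertices of \<open>p\<close> form the smaller
      side.\<close>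
    have sub: "{..<s} \<subseteq> {..<t}"
      using s_le_t by auto
    have "induced_mono_copy n R B ?H"
    proof (rule induced_mono_copy_blocksI[OF G[OF H] V, where p = p and q = q])
      show "inj_on p {..<s}"
        using p(1) sub by (rule inj_on_subset)
      show "p ` {..<s} \<subseteq> {..<n}"
        using p(2) s_le_t by (auto simp: image_subset_iff)
      have "p ` {..<s} \<subseteq> p ` {..<t}"
        using sub by (rule image_mono)
      then show "p ` {..<s} \<inter> q ` {..<t} = {}"
        using disj by (metis Int_mono order_refl subset_empty)
    qed (use q cross pp' qq' that s_le_t in \<open>auto simp: complete_bipartite_graph_edge_iff\<close>)
    then show False
      using avoid[OF H] by blast
  qed
  moreover
  let ?H = "complete_split_graph t t"
  have H: "?H \<in> L_family r s t" and V: "fst ?H = {..<t + t}"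
    by (auto simp: L_family_def complete_split_graph_def)
  have False if "\<alpha>" "\<not> \<beta>"
  proof -
    have "induced_mono_copy n R B ?H"
      by (rule induced_mono_copy_blocksI[OF G[OF H] V p q disj cross pp' qq'])
        (use that in \<open>auto simp: complete_split_graph_edge_iff\<close>)
    then show False
      using avoid[OF H] by blast
  qed
  moreover have False if "\<beta>" "\<not> \<alpha>"
  proof -
    \<comment> \<open>The clique comes first in the split graph, so \<open>p\<close> and
      \<open>q\<close> trade places.\<close>
    have "q ` {..<t} \<inter> p ` {..<t} = {}"
      using disj by blast
    then have "induced_mono_copy n R B ?H"
      by (rule induced_mono_copy_blocksI[OF G[OF H] V q p _ cross' qq' pp'])
        (use that in \<open>auto simp: complete_split_graph_edge_iff\<close>)
    then show False
      using avoid[OF H] by blast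
  qed
  ultimately show ?thesis
    by blast
qed

text \<open>For red cross edges this is \<open>red_blocks\<close>; for blue ones it is
  \<open>red_blocks\<close> with the colors exchanged.\<close>

lemma homogeneous_blocks:
  assumes p: "inj_on p {..<t}" "p ` {..<t} \<subseteq> {..<n}"
    and q: "inj_on q {..<t}" "q ` {..<t} \<subseteq> {..<n}"
    and disj: "p ` {..<t} \<inter> q ` {..<t} = {}"
    and cross: "\<And>i j. i < t \<Longrightarrow> j < t \<Longrightarrow> {p i, q j} \<in> R \<longleftrightarrow> \<chi>"
    and pp: "\<And>i j. i < j \<Longrightarrow> j < t \<Longrightarrow> {p i, p j} \<in> R \<longleftrightarrow> \<alpha>"
    and qq: "\<And>i j. i < j \<Longrightarrow> j < t \<Longrightarrow> {q i, q j} \<in> R \<longleftrightarrow> \<beta>"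
  shows "\<alpha> = \<chi>" "\<beta> = \<chi>"
proof -
  have "\<alpha> = \<chi> \<and> \<beta> = \<chi>"
  proof (cases \<chi>)
    case True
    then show ?thesis
      using red_blocks[OF p q disj, of \<alpha> \<beta>] cross pp qq by simp
  next
    case False
    have p_blue: "{p i, p j} \<in> B \<longleftrightarrow> \<not> \<alpha>" if "i < j" "j < t" for i j
      using blue_iff[of "p i" "p j"] pp[OF that] inj_onD[OF p(1), of i j] p(2) that
      by (auto simp: image_subset_iff)
    have q_blue: "{q i, q j} \<in> B \<longleftrightarrow> \<not> \<beta>" if "i < j" "j < t" for i j
      using blue_iff[of "q i" "q j"] qq[OF that] inj_onD[OF q(1), of i j] q(2) that
      by (auto simp: image_subset_iff)
    have "{p i, q j} \<in> B" if "i < t" "j < t" for i j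
    proof -
      have "p i \<noteq> q j"
        using disj that by blast
      then show ?thesis
        using blue_iff[of "p i" "q j"] cross[OF that] False p(2) q(2) that
        by (auto simp: image_subset_iff)
    qed
    then have "\<not> \<alpha> \<and> \<not> \<beta>"
      using p_blue q_blue by (rule avoiding_coloring.red_blocks[OF swap p q disj])
    then show ?thesis
      using False by simp
  qed
  then show "\<alpha> = \<chi>" "\<beta> = \<chi>"
    by auto
qed

text \<open>The four relations are the colors within \<open>a\<close>, within \<open>b\<close>, and
  from \<open>a\<close> to \<open>b\<close> and from \<open>b\<close> to \<open>a\<close> in
  increasing index order. Homogeneity makes all four constants equal. If they were blue, the
  matching edges would be the only red ones and form an induced \<open>rK_2\<close>; hence they are
  red.\<close>

lemma clique_if_matching:
  assumes N: "\<And>Ps :: (nat \<Rightarrow> nat \<Rightarrow> bool) list. length Ps = 4 \<Longrightarrow>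
     \<exists>h. strict_mono_on {..<k} h \<and> h ` {..<k} \<subseteq> {..<N} \<and>
       (\<forall>P \<in> set Ps. \<exists>c. \<forall>i j. i < j \<and> j < k \<longrightarrow> P (h i) (h j) = c)"
    and k: "2 * t \<le> k" "r \<le> k"
    and ab: "inj_on a {..<N}" "inj_on b {..<N}" "a ` {..<N} \<inter> b ` {..<N} = {}"
    and edge: "\<And>i. i < N \<Longrightarrow> {a i, b i} \<in> R"
  shows "\<exists>c. inj_on c {..<k} \<and> c ` {..<k} \<subseteq> {..<n} \<and> (\<forall>i j. i < j \<and> j < k \<longrightarrow> {c i, c j} \<in> R)"
proof -
  obtain h \<alpha> \<beta> \<chi> \<upsilon> where h: "strict_mono_on {..<k} h" "h ` {..<k} \<subseteq> {..<N}"
    and hom: "\<forall>i j. i < j \<and> j < k \<longrightarrow> ({a (h i), a (h j)} \<in> R) = \<alpha>"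
      "\<forall>i j. i < j \<and> j < k \<longrightarrow> ({b (h i), b (h j)} \<in> R) = \<beta>"
      "\<forall>i j. i < j \<and> j < k \<longrightarrow> ({a (h i), b (h j)} \<in> R) = \<chi>"
      "\<forall>i j. i < j \<and> j < k \<longrightarrow> ({b (h i), a (h j)} \<in> R) = \<upsilon>"
    using N[of "[\<lambda>i j. {a i, a j} \<in> R, \<lambda>i j. {b i, b j} \<in> R,
        \<lambda>i j. {a i, b j} \<in> R, \<lambda>i j. {b i, a j} \<in> R]"]
    by auto
  define a' b' where "a' = a \<circ> h" and "b' = b \<circ> h"
  have hN: "h i < N" if "i < k" for i
    using h(2) that by auto
  have inj_h: "inj_on h {..<k}"
    using h(1) by (rule strict_mono_on_imp_inj_on)
  have inj: "inj_on a' {..<k}" "inj_on b' {..<k}"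
    unfolding a'_def b'_def using ab(1,2) h(2) inj_h by (auto intro: comp_inj_on inj_on_subset)
  have ne: "a' i \<noteq> b' j" if "i < k" "j < k" for i j
    using ab(3) hN that unfolding a'_def b'_def by fastforce
  have edge': "{a' i, b' i} \<in> R" if "i < k" for i
    unfolding a'_def b'_def using edge hN that by auto
  have "R \<subseteq> [{..<n}]\<^bsup>2\<^esup>"
    using coloring by (auto simp: two_edge_coloring_def)
  \<comment> \<open>Both values are endpoints of a red matching edge, hence vertices.\<close>
  then have less_n: "a' i < n" "b' i < n" if "i < k" for i
    using edge'[OF that] by (meson doubleton_in_nsets_2 lessThan_iff subsetD)+
  have aa: "{a' i, a' j} \<in> R \<longleftrightarrow> \<alpha>" and bb: "{b' i, b' j} \<in> R \<longleftrightarrow> \<beta>"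
    and ab': "{a' i, b' j} \<in> R \<longleftrightarrow> \<chi>" and ba: "{b' i, a' j} \<in> R \<longleftrightarrow> \<upsilon>" if "i < j" "j < k" for i j
    using hom that unfolding a'_def b'_def by auto
  have shift: "inj_on (\<lambda>i. u (t + i)) {..<t}" if "inj_on u {..<k}" for u :: "nat \<Rightarrow> nat"
    using inj_onD[OF that] k by (intro inj_onI) fastforce
  have front: "inj_on u {..<t}" if "inj_on u {..<k}" for u :: "nat \<Rightarrow> nat"
    using that k by (auto simp: inj_on_def)
  \<comment> \<open>Indices below \<open>t\<close> on the side of \<open>a'\<close> against indices
    from \<open>t\<close> to \<open>2 * t - 1\<close> on the side of \<open>b'\<close>: every cross
    pair is increasing, so its color is \<open>\<chi>\<close>, and the matching edges do not
    interfere.\<close>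
  have "\<alpha> = \<chi>" "\<beta> = \<chi>"
    by (rule homogeneous_blocks[of a' "\<lambda>i. b' (t + i)" \<chi> \<alpha> \<beta>];
        use k inj less_n ne aa bb ab' front shift in \<open>force simp: image_subset_iff\<close>)+
  \<comment> \<open>The same comparison with the sides exchanged reaches the other order of cross
    pairs.\<close>
  moreover have "\<alpha> = \<upsilon>"
    by (rule homogeneous_blocks[of b' "\<lambda>i. a' (t + i)" \<upsilon> \<beta> \<alpha>];
        use k inj less_n ne[symmetric] aa bb ba front shift in \<open>force simp: image_subset_iff\<close>)
  moreover have \<alpha>
  proof (rule ccontr)
    assume "\<not> \<alpha>"
    let ?H = "matching_graph r"
    \<comment> \<open>Vertices \<open>2 * i\<close> and \<open>2 * i + 1\<close> go to the two ends
      of matching edge \<open>i\<close>.\<close>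
    define f where "f = (\<lambda>i. if even i then a' (i div 2) else b' (i div 2))"
    have H: "?H \<in> L_family r s t" and V: "fst ?H = {..<2 * r}"
      by (auto simp: L_family_def matching_graph_def)
    have blue: "{a' i, a' j} \<notin> R" "{b' i, b' j} \<notin> R" "{a' i, b' j} \<notin> R" "{b' j, a' i} \<notin> R"
      if "i < k" "j < k" "i \<noteq> j" for i j
      using aa[of i j] aa[of j i] bb[of i j] bb[of j i] ab'[of i j] ba[of j i] that \<open>\<not> \<alpha>\<close>
        \<open>\<alpha> = \<chi>\<close> \<open>\<beta> = \<chi>\<close> \<open>\<alpha> = \<upsilon>\<close> by (metis insert_commute linorder_neqE_nat)+
    have half: "i div 2 < k" if "i \<in> fst ?H" for i
      using that k(2) unfolding V by auto
    have "induced_mono_copy n R B ?H"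
    proof (rule induced_mono_copyI[OF L_family_graph[OF H], of f])
      fix i j assume ij: "i \<in> fst ?H" "j \<in> fst ?H" "i \<noteq> j"
      show "{f i, f j} \<in> R \<longleftrightarrow> {i, j} \<in> snd ?H"
      proof (cases "i div 2 = j div 2")
        case True
        then have "even i \<longleftrightarrow> odd j"
          using ij(3) by presburger
        then have "{f i, f j} \<in> R"
          unfolding f_def using True edge'[OF half[OF ij(2)]] by (auto simp: insert_commute)
        then show ?thesis
          using True ij unfolding matching_graph_edge_iff V by auto
      next
        case False
        then show ?thesis
          unfolding f_def matching_graph_edge_iff using blue half ij(1,2) by auto
      qed
    next
      show "inj_on f (fst ?H)"
      proof (rule inj_onI)
        fix i j assume ij: "i \<in> fst ?H" "j \<in> fst ?H" "f i = f j"
        have "even i \<longleftrightarrow> even j"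
          using ij(3) ne[OF half half] ij(1,2) unfolding f_def by (metis (full_types))
        moreover have "i div 2 = j div 2"
          using calculation ij(3) inj half[OF ij(1)] half[OF ij(2)]
          unfolding f_def by (auto simp: inj_on_def split: if_splits)
        ultimately show "i = j"
          by presburger
      qed
      show "f ` fst ?H \<subseteq> {..<n}"
        unfolding f_def using less_n half by auto
    qed
    then show False
      using avoid[OF H] by blast
  qed
  ultimately show ?thesis
    using inj(1) less_n(1) aa by (intro exI[of _ a']) auto
qed

text \<open>After making the cross colors homogeneous, \<open>t\<close> vertices of the red clique
  and \<open>t\<close> of the blue one are joined in a single color. The clique of that color and
  the other clique then form a monochromatic \<open>S_{t,t}\<close>.\<close>

lemma no_two_cliques:
  assumes N: "\<And>P :: nat \<Rightarrow> nat \<Rightarrow> bool. \<exists>h. strict_mono_on {..<2 * t} h \<and>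
      h ` {..<2 * t} \<subseteq> {..<N} \<and> (\<exists>c. \<forall>i j. i < j \<and> j < 2 * t \<longrightarrow> P (h i) (h j) = c)"
    and c: "inj_on c {..<N}" "c ` {..<N} \<subseteq> {..<n}" "\<And>i j. i < j \<Longrightarrow> j < N \<Longrightarrow> {c i, c j} \<in> R"
    and d: "inj_on d {..<N}" "d ` {..<N} \<subseteq> {..<n}" "\<And>i j. i < j \<Longrightarrow> j < N \<Longrightarrow> {d i, d j} \<in> B"
    and disj: "c ` {..<N} \<inter> d ` {..<N} = {}"
  shows False
proof -
  obtain h \<chi> where h: "strict_mono_on {..<2 * t} h" "h ` {..<2 * t} \<subseteq> {..<N}"
      "\<And>i j. i < j \<Longrightarrow> j < 2 * t \<Longrightarrow> {c (h i), d (h j)} \<in> R \<longleftrightarrow> \<chi>"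
    using N[of "\<lambda>i j. {c i, d j} \<in> R"] by auto
  have hN: "h i < N" if "i < 2 * t" for i
    using h(2) that by auto
  have hm: "h i < h j" if "i < j" "j < 2 * t" for i j
    using h(1) that by (auto simp: strict_mono_on_def)
  have ne: "h i \<noteq> h j" if "i \<noteq> j" "i < 2 * t" "j < 2 * t" for i j
    using hm[of i j] hm[of j i] that by linarith
  have d_red: "{d i, d j} \<notin> R" if "i < j" "j < N" for i j
    using d(3)[OF that] coloring by (auto simp: two_edge_coloring_def)
  let ?p = "\<lambda>i. c (h i)" and ?q = "\<lambda>i. d (h (t + i))"
  have 1: "inj_on ?p {..<t}"
  proof (rule inj_onI)
    fix i j assume "i \<in> {..<t}" "j \<in> {..<t}" "?p i = ?p j"
    then show "i = j"
      using inj_onD[OF c(1), of "h i" "h j"] hN[of i] hN[of j] ne[of i j] by auto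
  qed
  have 2: "inj_on ?q {..<t}"
  proof (rule inj_onI)
    fix i j assume "i \<in> {..<t}" "j \<in> {..<t}" "?q i = ?q j"
    then show "i = j"
      using inj_onD[OF d(1), of "h (t + i)" "h (t + j)"] hN[of "t + i"] hN[of "t + j"]
        ne[of "t + i" "t + j"] by auto
  qed
  have "?p i \<noteq> ?q j" if "i < t" "j < t" for i j
  proof -
    have "h i < N" "h (t + j) < N"
      using hN that by auto
    then show ?thesis
      using disj by blast
  qed
  then have 3: "?p ` {..<t} \<subseteq> {..<n}" "?q ` {..<t} \<subseteq> {..<n}" "?p ` {..<t} \<inter> ?q ` {..<t} = {}"
    using hN c(2) d(2) by (auto simp: image_subset_iff)
  have 4: "{?p i, ?q j} \<in> R \<longleftrightarrow> \<chi>" if "i < t" "j < t" for i j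
    using h(3) that by simp
  have 5: "{?p i, ?p j} \<in> R \<longleftrightarrow> True" if "i < j" "j < t" for i j
    using c(3)[of "h i" "h j"] hm hN that by simp
  have 6: "{?q i, ?q j} \<in> R \<longleftrightarrow> False" if "i < j" "j < t" for i j
    using d_red[of "h (t + i)" "h (t + j)"] hm hN that by simp
  \<comment> \<open>The color \<open>\<chi>\<close> would have to equal both True and False.\<close>
  show False
    using homogeneous_blocks[OF 1 3(1) 2 3(2,3) 4 5 6] by blast
qed

end

text \<open>Serves to make two cliques disjoint: by injectivity at most one index has value
  \<open>x\<close>, and \<open>g\<close> skips it.\<close>

lemma inj_on_avoid_point:
  fixes c :: "nat \<Rightarrow> 'a"
  assumes "inj_on c {..<Suc N}"
  shows "\<exists>g. strict_mono_on {..<N} g \<and> g ` {..<N} \<subseteq> {..<Suc N} \<and> x \<notin> c ` g ` {..<N}"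
proof (cases "\<exists>m < Suc N. c m = x")
  case True
  then obtain m where m: "m < Suc N" "c m = x" by blast
  let ?g = "\<lambda>i. if i < m then i else Suc i"
  have "c (?g i) \<noteq> x" if "i < N" for i
    using inj_onD[OF assms, of "?g i" m] m that by (auto split: if_splits)
  then have "x \<notin> c ` ?g ` {..<N}"
    by blast
  then show ?thesis
    by (intro exI[of _ ?g]) (auto simp: strict_mono_on_def)
next
  case False
  then have "c i \<noteq> x" if "i < N" for i
    using that by auto
  then have "x \<notin> c ` id ` {..<N}"
    by auto
  then show ?thesis
    by (intro exI[of _ id]) (auto simp: strict_mono_on_def)
qed

lemma forces_mono_linear:
  assumes "2 \<le> s" "s \<le> t"
  shows "\<exists>C. \<forall>n. forces_mono n (C * n) (L_family r s t)"
proof -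
  obtain N where N: "\<And>P :: nat \<Rightarrow> nat \<Rightarrow> bool. \<exists>h. strict_mono_on {..<2 * t} h \<and>
      h ` {..<2 * t} \<subseteq> {..<N} \<and> (\<exists>c. \<forall>i j. i < j \<and> j < 2 * t \<longrightarrow> P (h i) (h j) = c)"
    using ramsey_increasing[of "2 * t"] by blast
  \<comment> \<open>\<open>N\<close> vertices are required by \<open>no_two_cliques\<close>, one
    more may be discarded, and \<open>2 * t\<close> and \<open>r\<close> are the sizes demanded by
    \<open>clique_if_matching\<close>.\<close>
  define k where "k = Suc N + 2 * t + r"
  obtain M where M: "\<And>Ps :: (nat \<Rightarrow> nat \<Rightarrow> bool) list. length Ps = 4 \<Longrightarrow>
     \<exists>h. strict_mono_on {..<k} h \<and> h ` {..<k} \<subseteq> {..<M} \<and>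
       (\<forall>P \<in> set Ps. \<exists>c. \<forall>i j. i < j \<and> j < k \<longrightarrow> P (h i) (h j) = c)"
    using ramsey_increasing_list[of 4 k] by blast
  have clique: "\<exists>c. inj_on c {..<k} \<and> c ` {..<k} \<subseteq> {..<n} \<and>
      (\<forall>i j. i < j \<and> j < k \<longrightarrow> {c i, c j} \<in> R)"
    if col: "avoiding_coloring n r s t R B" "card R > 2 * M * n" for n R B
  proof -
    have "R \<subseteq> [{..<n}]\<^bsup>2\<^esup>"
      using avoiding_coloring.coloring[OF col(1)] by (auto simp: two_edge_coloring_def)
    then obtain a b where "inj_on a {..<M}" "inj_on b {..<M}" "a ` {..<M} \<inter> b ` {..<M} = {}"
        "\<And>i. i < M \<Longrightarrow> {a i, b i} \<in> R"
      using matching_if_many_edges[OF _ col(2)] by metis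
    then show ?thesis
      using avoiding_coloring.clique_if_matching[OF col(1) M, of a b] by (simp add: k_def)
  qed
  have "\<exists>H\<in>L_family r s t. induced_mono_copy n R B H"
    if col: "two_edge_coloring n R B" "card R > 2 * M * n" "card B > 2 * M * n" for n R B
  proof (rule ccontr)
    assume "\<not> ?thesis"
    then interpret avoiding_coloring n r s t R B
      using col assms by unfold_locales auto
    obtain c where c: "inj_on c {..<k}" "c ` {..<k} \<subseteq> {..<n}"
        "\<And>i j. i < j \<Longrightarrow> j < k \<Longrightarrow> {c i, c j} \<in> R"
      using clique[OF avoiding_coloring_axioms col(2)] by metis
    obtain d where d: "inj_on d {..<k}" "d ` {..<k} \<subseteq> {..<n}"
        "\<And>i j. i < j \<Longrightarrow> j < k \<Longrightarrow> {d i, d j} \<in> B"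
      using clique[OF swap col(3)] by metis
    \<comment> \<open>Two common vertices would span an edge that is both red and blue.\<close>
    have meet: "x = y"
      if "x \<in> c ` {..<k}" "x \<in> d ` {..<k}" "y \<in> c ` {..<k}" "y \<in> d ` {..<k}" for x y
    proof (rule ccontr)
      assume "x \<noteq> y"
      have "{x, y} \<in> R"
        using that(1,3) c(3) \<open>x \<noteq> y\<close> by (auto) (metis insert_commute linorder_neqE_nat)
      moreover have "{x, y} \<in> B"
        using that(2,4) d(3) \<open>x \<noteq> y\<close> by (auto) (metis insert_commute linorder_neqE_nat)
      ultimately show False
        using coloring by (auto simp: two_edge_coloring_def)
    qed
    \<comment> \<open>The single common vertex of the cliques if there is one; otherwise an
      arbitrary value, whose removal does no harm.\<close>
    define x where "x = (SOME x. x \<in> c ` {..<k} \<inter> d ` {..<k})"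
    have x: "y = x" if "y \<in> c ` {..<k}" "y \<in> d ` {..<k}" for y
      using meet that someI[of "\<lambda>x. x \<in> c ` {..<k} \<inter> d ` {..<k}" y] unfolding x_def by blast
    have "inj_on c {..<Suc N}"
      using c(1) by (auto simp: k_def inj_on_def)
    then obtain g where g: "strict_mono_on {..<N} g" "g ` {..<N} \<subseteq> {..<Suc N}"
        "x \<notin> c ` g ` {..<N}"
      using inj_on_avoid_point[of c N x] by metis
    have gk: "g i < k" if "i < N" for i
      using g(2) that by (force simp: k_def)
    have gm: "g i < g j" if "i < j" "j < N" for i j
      using g(1) that by (auto simp: strict_mono_on_def)
    show False
    proof (rule no_two_cliques[OF N, of "c \<circ> g" d])
      show "inj_on (c \<circ> g) {..<N}"
        using strict_mono_on_imp_inj_on[OF g(1)] c(1) gk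
        by (intro comp_inj_on) (auto intro: inj_on_subset)
      show "(c \<circ> g) ` {..<N} \<subseteq> {..<n}"
        using c(2) gk by auto
      show "{(c \<circ> g) i, (c \<circ> g) j} \<in> R" if "i < j" "j < N" for i j
        using c(3) gm gk that by simp
      show "inj_on d {..<N}" "d ` {..<N} \<subseteq> {..<n}"
        using d(1,2) by (auto simp: k_def inj_on_def image_subset_iff)
      show "{d i, d j} \<in> B" if "i < j" "j < N" for i j
        using d(3) that by (simp add: k_def)
      show "(c \<circ> g) ` {..<N} \<inter> d ` {..<N} = {}"
      proof (rule ccontr)
        assume "\<not> ?thesis"
        then obtain i j where "i < N" "j < N" "c (g i) = d j"
          by auto
        moreover have "d j \<in> d ` {..<k}" "c (g i) \<in> c ` {..<k}"
          using gk \<open>i < N\<close> \<open>j < N\<close> by (auto simp: k_def)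
        ultimately have "c (g i) = x"
          using x by metis
        then show False
          using g(3) \<open>i < N\<close> by auto
      qed
    qed
  qed
  then have "\<forall>n. forces_mono n (2 * M * n) (L_family r s t)"
    unfolding forces_mono_def by blast
  then show ?thesis
    by blast
qed

section \<open>The lower bound\<close>

definition star_edges :: "nat \<Rightarrow> nat set set" where
  "star_edges n = {{0, i} | i. 0 < i \<and> i < n}"

lemma star_edges_iff: "{x, y} \<in> star_edges n \<longleftrightarrow> x \<noteq> y \<and> (x = 0 \<or> y = 0) \<and> x < n \<and> y < n"
  by (auto simp: star_edges_def doubleton_eq_iff)

lemma star_edges_subset: "star_edges n \<subseteq> [{..<n}]\<^bsup>2\<^esup>"
  by (auto simp: star_edges_def)

lemma card_star_edges: "card (star_edges n) = n - 1"
proof -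
  have "star_edges n = (\<lambda>i. {0, i}) ` {0<..<n}"
    by (auto simp: star_edges_def)
  moreover have "inj_on (\<lambda>i. {0, i}) {0<..<n}"
    by (auto simp: inj_on_def doubleton_eq_iff)
  ultimately show ?thesis
    by (simp add: card_image)
qed

text \<open>Red edges pairwise meet in the centre, but each member of the family has two disjoint
  edges. The blue graph is a clique plus the isolated centre, so non-isolated vertices are adjacent,
  but each member has two non-adjacent vertices with neighbours.\<close>

lemma star_coloring_avoids:
  assumes "2 \<le> r" "2 \<le> s" "s \<le> t" "H \<in> L_family r s t"
  shows "\<not> induced_mono_copy n (star_edges n) ([{..<n}]\<^bsup>2\<^esup> - star_edges n) H"
proof
  let ?B = "[{..<n}]\<^bsup>2\<^esup> - star_edges n"
  assume "induced_mono_copy n (star_edges n) ?B H"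
  then obtain U E where U: "U \<subseteq> {..<n}" "E = star_edges n \<or> E = ?B"
      "graph_isomorphic (U, E \<inter> [U]\<^bsup>2\<^esup>) H"
    unfolding induced_mono_copy_def by metis
  from U(3) obtain g where g: "inj_on g (fst H)" "g ` fst H \<subseteq> U"
    "\<And>i j. i \<in> fst H \<Longrightarrow> j \<in> fst H \<Longrightarrow> i \<noteq> j \<Longrightarrow> {i, j} \<in> snd H \<longleftrightarrow> {g i, g j} \<in> E"
    by (rule graph_isomorphic_edgesE) blast
  \<comment> \<open>The only possible preimage of the centre \<open>0\<close>. If there is none,
    \<open>v\<close> is arbitrary and the next fact is vacuous.\<close>
  define v where "v = inv_into (fst H) g 0"
  have v: "g i = 0 \<Longrightarrow> i = v" if "i \<in> fst H" for i
    unfolding v_def using g(1) that by (metis inv_into_f_f)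
  \<comment> \<open>The two alternatives are the red and the blue copy: adjacency depends only on
    whether the centre is involved.\<close>
  have "(\<forall>i\<in>fst H. \<forall>j\<in>fst H. i \<noteq> j \<longrightarrow> ({i, j} \<in> snd H \<longleftrightarrow> g i = 0 \<or> g j = 0)) \<or>
    (\<forall>i\<in>fst H. \<forall>j\<in>fst H. i \<noteq> j \<longrightarrow> ({i, j} \<in> snd H \<longleftrightarrow> g i \<noteq> 0 \<and> g j \<noteq> 0))"
  proof -
    have "g i \<noteq> g j" "g i < n" "g j < n" if "i \<in> fst H" "j \<in> fst H" "i \<noteq> j" for i j
      using g(1,2) U(1) that by (auto simp: inj_on_def)
    note * = this
    show ?thesis
      using U(2)
    proof
      assume "E = star_edges n"
      then show ?thesis
        using * g(3) by (intro disjI1) (auto simp: star_edges_iff)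
    next
      assume "E = ?B"
      then show ?thesis
        using * g(3) by (intro disjI2) (auto simp: star_edges_iff)
    qed
  qed
  then show False
  proof
    assume *: "\<forall>i\<in>fst H. \<forall>j\<in>fst H. i \<noteq> j \<longrightarrow> ({i, j} \<in> snd H \<longleftrightarrow> g i = 0 \<or> g j = 0)"
    \<comment> \<open>Two disjoint edges: both would have to contain \<open>v\<close>.\<close>
    have "\<exists>a b c d. {a, b, c, d} \<subseteq> fst H \<and> distinct [a, b, c, d] \<and> {a, b} \<in> snd H \<and> {c, d} \<in> snd H"
      using assms(4) unfolding L_family_def
    proof (elim insertE emptyE)
      assume H: "H = matching_graph r"
      show ?thesis
        unfolding H using assms(1)
        by (intro exI[of _ 0] exI[of _ 1] exI[of _ 2] exI[of _ 3])
          (simp only: matching_graph_edge_iff, simp add: matching_graph_def)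
    next
      assume H: "H = complete_bipartite_graph s t"
      show ?thesis
        unfolding H using assms(2,3)
        by (intro exI[of _ 0] exI[of _ s] exI[of _ 1] exI[of _ "s + 1"])
          (simp only: complete_bipartite_graph_edge_iff, simp add: complete_bipartite_graph_def)
    next
      assume H: "H = complete_split_graph t t"
      show ?thesis
        unfolding H using assms(2,3)
        by (intro exI[of _ 0] exI[of _ t] exI[of _ 1] exI[of _ "t + 1"])
          (simp only: complete_split_graph_edge_iff, simp add: complete_split_graph_def)
    qed
    then show False
      using * v by (metis distinct_length_2_or_more insert_subset)
  next
    assume *: "\<forall>i\<in>fst H. \<forall>j\<in>fst H. i \<noteq> j \<longrightarrow> ({i, j} \<in> snd H \<longleftrightarrow> g i \<noteq> 0 \<and> g j \<noteq> 0)"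
    \<comment> \<open>A non-adjacent pair \<open>a\<close>, \<open>b\<close> with neighbours
      \<open>c\<close> and \<open>d\<close>. The neighbours show that neither \<open>a\<close> nor
      \<open>b\<close> is mapped to the centre, so \<open>{a, b}\<close> would have to be an
      edge.\<close>
    have "\<exists>a b c d. {a, b, c, d} \<subseteq> fst H \<and> distinct [a, b, c, d] \<and> {a, b} \<notin> snd H \<and>
        {a, c} \<in> snd H \<and> {b, d} \<in> snd H"
      using assms(4) unfolding L_family_def
    proof (elim insertE emptyE)
      assume H: "H = matching_graph r"
      show ?thesis
        unfolding H using assms(1)
        by (intro exI[of _ 0] exI[of _ 2] exI[of _ 1] exI[of _ 3])
          (simp only: matching_graph_edge_iff, simp add: matching_graph_def)
    next
      assume H: "H = complete_bipartite_graph s t"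
      show ?thesis
        unfolding H using assms(2,3)
        by (intro exI[of _ 0] exI[of _ 1] exI[of _ s] exI[of _ "s + 1"])
          (simp only: complete_bipartite_graph_edge_iff, simp add: complete_bipartite_graph_def)
    next
      assume H: "H = complete_split_graph t t"
      show ?thesis
        unfolding H using assms(2,3)
        by (intro exI[of _ t] exI[of _ "t + 1"] exI[of _ 0] exI[of _ 1])
          (simp only: complete_split_graph_edge_iff, simp add: complete_split_graph_def)
    qed
    then obtain a b c d where "{a, b, c, d} \<subseteq> fst H" "distinct [a, b, c, d]"
        "{a, b} \<notin> snd H" "{a, c} \<in> snd H" "{b, d} \<in> snd H"
      by blast
    then show False
      using * by auto
  qed
qed

text \<open>The star has \<open>n - 1\<close> red edges and avoids the family, so a smaller
  \<open>m\<close> cannot force a copy once blue is at least as large.\<close>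

lemma forces_mono_lower_bound:
  assumes "2 \<le> r" "2 \<le> s" "s \<le> t" "4 \<le> n" "forces_mono n m (L_family r s t)"
  shows "n - 1 \<le> m"
proof (rule ccontr)
  assume "\<not> n - 1 \<le> m"
  let ?B = "[{..<n}]\<^bsup>2\<^esup> - star_edges n"
  have col: "two_edge_coloring n (star_edges n) ?B"
    using star_edges_subset by (auto simp: two_edge_coloring_def)
  have "finite (star_edges n)"
    using star_edges_subset by (rule finite_subset) (simp add: finite_imp_finite_nsets)
  then have card_B: "card ?B = (n choose 2) - (n - 1)"
    using star_edges_subset by (simp add: card_Diff_subset card_star_edges)
  \<comment> \<open>From \<open>n = 4\<close> on, the complement of the star has at least
    \<open>n - 1\<close> edges.\<close>
  have "4 * (n - 1) \<le> n * (n - 1)"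
    using assms(4) by (intro mult_right_mono) auto
  then have "2 * (n - 1) \<le> n choose 2"
    unfolding choose_two by linarith
  then have "card ?B > m" "card (star_edges n) > m"
    using \<open>\<not> n - 1 \<le> m\<close> card_B by (auto simp: card_star_edges)
  then obtain H where "H \<in> L_family r s t" "induced_mono_copy n (star_edges n) ?B H"
    using assms(5) col unfolding forces_mono_def by blast
  then show False
    using star_coloring_avoids assms by blast
qed

section \<open>Combining the two bounds\<close>

theorem theorem2p8:
  fixes r s t :: nat
  assumes "r \<ge> 2" and "s \<ge> 2" and "t \<ge> s"
  shows "(\<forall>\<^sub>F n in sequentially. ex2 n (L_family r s t) \<noteq> \<infinity>) \<and>
         (\<lambda>n. real (the_enat (ex2 n (L_family r s t)))) \<in> \<Theta>(\<lambda>n. real n)"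
proof -
  let ?F = "L_family r s t"
  obtain C where C: "\<And>n. forces_mono n (C * n) ?F"
    using forces_mono_linear[OF assms(2,3)] by blast
  have bounds: "\<exists>e. ex2 n ?F = enat e \<and> n - 1 \<le> e \<and> e \<le> C * n" if n: "4 * C + 8 \<le> n" for n
  proof -
    let ?A = "{enat m | m. m < (n choose 2) div 2 \<and> forces_mono n m ?F}"
    \<comment> \<open>The threshold on \<open>n\<close> makes \<open>C * n\<close> smaller than half
      the number of edges, so that it is an admissible bound and the infimum is finite.\<close>
    have "(4 * C + 7) * n \<le> (n - 1) * n"
      using n by (intro mult_right_mono) auto
    then have "4 * (C * n + 1) \<le> n * (n - 1)"
      using n by (simp add: algebra_simps)
    then have "2 * (C * n + 1) \<le> n choose 2"
      unfolding choose_two by linarith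
    then have "C * n < (n choose 2) div 2"
      using div_le_mono[of "2 * (C * n + 1)" "n choose 2" 2] by simp
    then have upper: "enat (C * n) \<in> ?A"
      using C by blast
    then have le: "ex2 n ?F \<le> enat (C * n)"
      unfolding ex2_def by (rule Inf_lower)
    have "enat (n - 1) \<le> ex2 n ?F"
      unfolding ex2_def
      using forces_mono_lower_bound[OF assms, of n] n by (intro Inf_greatest) auto
    then show ?thesis
      using le by (cases "ex2 n ?F") auto
  qed
  have "\<forall>\<^sub>F n in sequentially. ex2 n ?F \<noteq> \<infinity>"
    using eventually_ge_at_top[of "4 * C + 8"] by eventually_elim (use bounds in force)
  moreover have "(\<lambda>n. real (the_enat (ex2 n ?F))) \<in> \<Theta>(\<lambda>n. real n)"
  \<comment> \<open>The factor \<open>1 / 2\<close> absorbs the \<open>- 1\<close> in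
    \<open>n - 1\<close>; \<open>C + 1\<close> instead of \<open>C\<close> keeps the upper constant
    positive even for \<open>C = 0\<close>.\<close>
  proof (rule bigthetaI'[of "1 / 2" "real C + 1"])
    show "\<forall>\<^sub>F n in sequentially. 1 / 2 * norm (real n) \<le> norm (real (the_enat (ex2 n ?F))) \<and>
        norm (real (the_enat (ex2 n ?F))) \<le> (real C + 1) * norm (real n)"
      using eventually_ge_at_top[of "4 * C + 8"]
    proof eventually_elim
      fix n assume n: "4 * C + 8 \<le> n"
      then obtain e where e: "ex2 n ?F = enat e" "n - 1 \<le> e" "e \<le> C * n"
        using bounds by blast
      have "n \<le> 2 * e"
        using e(2) n by linarith
      then have "real n \<le> 2 * real e"
        by linarith
      moreover have "real e \<le> real C * real n"
        using e(3) by (metis of_nat_le_iff of_nat_mult)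
      ultimately show "1 / 2 * norm (real n) \<le> norm (real (the_enat (ex2 n ?F))) \<and>
          norm (real (the_enat (ex2 n ?F))) \<le> (real C + 1) * norm (real n)"
        using e(1) by (simp add: algebra_simps)
    qed
  qed auto
  ultimately show ?thesis
    by blast
qed

end
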